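(* Let $(X,Y)$ be a norming dual pair and let $\tau_c$ be the locally convex topology on $X$ generated by the seminorms $p_{\mathcal{K}}(x)=\sup_{y\in\mathcal{K}}|\langle x,y\rangle|$, where $\mathcal{K}$ ranges over all $\sigma'$-compact subsets of $Y$. If $\mathbf{T}$ is a semigroup on $(X,Y)$ of type $(M,\omega)$ which is $\tau_c$-continuous, then $\mathbf{T}$ is ${}_\alpha$quasi-$\tau_c$-equicontinuous for every $\alpha>\omega$.
   Context: A dual pair $(X,Y,\langle\cdot,\cdot\rangle)$ consists of vector spaces over $\mathbb{K}=\mathbb{R}$ or $\mathbb{C}$ and a bilinear form $X\times Y\to\mathbb{K}$ separating points. It is a norming dual pair if $X,Y$ are Banach spaces with $\|x\|=\sup\{|\langle x,y\rangle|:y\in Y,\|y\|\le1\}$ and $\|y\|=\sup\{|\langle x,y\rangle|:x\in X,\|x\|\le1\}$. $\sigma=\sigma(X,Y)$ and $\sigma'=\sigma(Y,X)$ are the weak topologies on $X$ and $Y$. For a locally convex topology $\tau$ on $X$, $L(X,\tau)$ is the algebra of $\tau$-continuous linear operators on $X$. A semigroup on $(X,Y)$ is a family $\mathbf{T}=(T(t))_{t\ge0}\subset L(X,\sigma)$ with $T(0)=I$, $T(t+s)=T(t)T(s)$ for all $t,s\ge0$, which is exponentially bounded: $\|T(t)\|\le Me^{\omega t}$ for all $t\ge0$ and some $M\ge1$, $\omega\in\mathbb{R}$; then $\mathbf{T}$ is of type $(M,\omega)$. $\mathbf{T}$ is $\tau$-continuous if $t\mapsto T(t)x$ is $\tau$-continuous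 on $[0,\infty)$ for every $x\in X$. A set $\mathcal{S}\subset L(X,\tau)$ is $\tau$-equicontinuous if for every $\tau$-continuous seminorm $p$ there is a $\tau$-continuous seminorm $q$ with $p(Tx)\le q(x)$ for all $x\in X$, $T\in\mathcal{S}$. $\mathbf{T}$ is ${}_\alpha$quasi-$\tau$-equicontinuous if $\{e^{-\alpha t}T(t):t\ge0\}$ is $\tau$-equicontinuous. *)

theory Defs
  imports "HOL-Analysis.Analysis"
begin

text \<open>The scalar field is the field of real or of complex numbers. A type class allows a single
  statement to cover both cases; up to isometric isomorphism it has no other instances.\<close>

class real_or_complex_field = real_normed_field +
  assumes real_or_complex:
    "(\<exists>f :: 'a \<Rightarrow> real. bij f \<and> f 1 = 1 \<and> (\<forall>a b. f (a + b) = f a + f b) \<and>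
        (\<forall>a b. f (a * b) = f a * f b) \<and> (\<forall>a. norm (f a) = norm a)) \<or>
     (\<exists>f :: 'a \<Rightarrow> complex. bij f \<and> f 1 = 1 \<and> (\<forall>a b. f (a + b) = f a + f b) \<and>
        (\<forall>a b. f (a * b) = f a * f b) \<and> (\<forall>a. norm (f a) = norm a))"

instance real :: real_or_complex_field
  by standard (rule disjI1, rule exI[of _ "\<lambda>x. x"], simp add: bij_def)

instance complex :: real_or_complex_field
  by standard (rule disjI2, rule exI[of _ "\<lambda>x. x"], simp add: bij_def)

text \<open>Class \<open>banach\<close> only provides the underlying real Banach space, so multiplication by scalars in
  \<open>'k\<close> is an explicit parameter, which has to extend the real one.\<close>

locale banach_space_over = vector_space scaleK
  for scaleK :: "'k::real_or_complex_field \<Rightarrow> 'x::banach \<Rightarrow> 'x" +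
  assumes scale_of_real: "scaleK (of_real r) x = r *\<^sub>R x"
    and norm_scale: "norm (scaleK a x) = norm a * norm x"

locale dual_pair =
  X: vector_space scaleX + Y: vector_space scaleY
  for scaleX :: "'k::real_or_complex_field \<Rightarrow> 'x::ab_group_add \<Rightarrow> 'x"
    and scaleY :: "'k \<Rightarrow> 'y::ab_group_add \<Rightarrow> 'y"
    and pairing :: "'x \<Rightarrow> 'y \<Rightarrow> 'k" +
  assumes linear_left: "Vector_Spaces.linear scaleX (*) (\<lambda>x. pairing x y)"
    and linear_right: "Vector_Spaces.linear scaleY (*) (\<lambda>y. pairing x y)"
    and separates_left: "x \<noteq> 0 \<Longrightarrow> \<exists>y. pairing x y \<noteq> 0"
    and separates_right: "y \<noteq> 0 \<Longrightarrow> \<exists>x. pairing x y \<noteq> 0"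

text \<open>The assumptions \<open>bdd_above\<close> say that the suprema are finite; a supremum of an unbounded set
  of reals is unspecified in HOL.\<close>

locale norming_dual_pair =
  dual_pair scaleX scaleY pairing +
  X: banach_space_over scaleX + Y: banach_space_over scaleY
  for scaleX :: "'k::real_or_complex_field \<Rightarrow> 'x::banach \<Rightarrow> 'x"
    and scaleY :: "'k \<Rightarrow> 'y::banach \<Rightarrow> 'y"
    and pairing :: "'x \<Rightarrow> 'y \<Rightarrow> 'k" +
  assumes bdd_left: "bdd_above ((\<lambda>y. norm (pairing x y)) ` {y. norm y \<le> 1})"
    and norm_left: "norm x = (SUP y\<in>{y. norm y \<le> 1}. norm (pairing x y))"
    and bdd_right: "bdd_above ((\<lambda>x. norm (pairing x y)) ` {x. norm x \<le> 1})"
    and norm_right: "norm y = (SUP x\<in>{x. norm x \<le> 1}. norm (pairing x y))"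

text \<open>The initial topology on the first component of the pair, \<open>\<sigma>(X,Y)\<close>. The topology
  \<open>\<sigma>(Y,X)\<close> is obtained by exchanging the arguments of the pairing.\<close>

definition weak_topology :: "('x \<Rightarrow> 'y \<Rightarrow> 'k::topological_space) \<Rightarrow> 'x topology" where
  "weak_topology pairing =
     topology_generated_by {(\<lambda>x. pairing x y) -` U | y U. open U}"

definition lc_topology :: "('x::ab_group_add \<Rightarrow> real) set \<Rightarrow> 'x topology" where
  "lc_topology P = topology_generated_by {{x. p (x - a) < e} | p a e. p \<in> P \<and> e > 0}"

text \<open>The empty compact set is left out because the supremum of the empty set of reals is
  unspecified in HOL. It would contribute the zero seminorm, which \<open>\<K> = {0}\<close> already provides.\<close>

definition tau_c :: "('x::ab_group_add \<Rightarrow> 'y \<Rightarrow> 'k::real_normed_field) \<Rightarrow> 'x topology" where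
  "tau_c pairing = lc_topology
     {\<lambda>x. SUP y\<in>K. norm (pairing x y) | K.
        compactin (weak_topology (\<lambda>y x. pairing x y)) K \<and> K \<noteq> {}}"

definition continuous_operators ::
    "('k::field \<Rightarrow> 'x::ab_group_add \<Rightarrow> 'x) \<Rightarrow> 'x topology \<Rightarrow> ('x \<Rightarrow> 'x) set" where
  "continuous_operators scaleK \<tau> = {S. Vector_Spaces.linear scaleK scaleK S \<and> continuous_map \<tau> \<tau> S}"

text \<open>\<open>bounded_linear\<close> makes the operator norm \<open>onorm\<close> meaningful.\<close>

definition of_type :: "real \<Rightarrow> real \<Rightarrow> (real \<Rightarrow> 'x::real_normed_vector \<Rightarrow> 'x) \<Rightarrow> bool" where
  "of_type M \<omega> T \<longleftrightarrow> M \<ge> 1 \<and>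
     (\<forall>t\<ge>0. bounded_linear (T t) \<and> onorm (T t) \<le> M * exp (\<omega> * t))"

text \<open>Only the values \<open>T t\<close> with \<open>t \<ge> 0\<close> matter.\<close>

definition semigroup_on ::
    "('k::real_normed_field \<Rightarrow> 'x::real_normed_vector \<Rightarrow> 'x) \<Rightarrow> ('x \<Rightarrow> 'y \<Rightarrow> 'k) \<Rightarrow>
      (real \<Rightarrow> 'x \<Rightarrow> 'x) \<Rightarrow> bool" where
  "semigroup_on scaleK pairing T \<longleftrightarrow>
     (\<forall>t\<ge>0. T t \<in> continuous_operators scaleK (weak_topology pairing)) \<and>
     T 0 = id \<and> (\<forall>t\<ge>0. \<forall>s\<ge>0. T (t + s) = T t \<circ> T s) \<and>
     (\<exists>M \<omega>. of_type M \<omega> T)"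

definition semigroup_continuous :: "'x topology \<Rightarrow> (real \<Rightarrow> 'x \<Rightarrow> 'x) \<Rightarrow> bool" where
  "semigroup_continuous \<tau> T \<longleftrightarrow> (\<forall>x. continuous_map (top_of_set {0..}) \<tau> (\<lambda>t. T t x))"

definition continuous_seminorm ::
    "('k::real_normed_field \<Rightarrow> 'x::ab_group_add \<Rightarrow> 'x) \<Rightarrow> 'x topology \<Rightarrow> ('x \<Rightarrow> real) \<Rightarrow> bool" where
  "continuous_seminorm scaleK \<tau> p \<longleftrightarrow>
     (\<forall>x. p x \<ge> 0) \<and> (\<forall>x y. p (x + y) \<le> p x + p y) \<and> (\<forall>a x. p (scaleK a x) = norm a * p x) \<and>
     continuous_map \<tau> euclidean p"

definition equicontinuous_operators ::
    "('k::real_normed_field \<Rightarrow> 'x::ab_group_add \<Rightarrow> 'x) \<Rightarrow> 'x topology \<Rightarrow> ('x \<Rightarrow> 'x) set \<Rightarrow> bool" where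
  "equicontinuous_operators scaleK \<tau> \<S> \<longleftrightarrow>
     \<S> \<subseteq> continuous_operators scaleK \<tau> \<and>
     (\<forall>p. continuous_seminorm scaleK \<tau> p \<longrightarrow>
        (\<exists>q. continuous_seminorm scaleK \<tau> q \<and> (\<forall>S\<in>\<S>. \<forall>x. p (S x) \<le> q x)))"

definition quasi_equicontinuous ::
    "('k::real_normed_field \<Rightarrow> 'x::ab_group_add \<Rightarrow> 'x) \<Rightarrow> 'x topology \<Rightarrow> real \<Rightarrow>
      (real \<Rightarrow> 'x \<Rightarrow> 'x) \<Rightarrow> bool" where
  "quasi_equicontinuous scaleK \<tau> \<alpha> T \<longleftrightarrow>
     equicontinuous_operators scaleK \<tau>
       {\<lambda>x. scaleK (of_real (exp (- \<alpha> * t))) (T t x) | t. t \<ge> 0}"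

end

theory Submission
  imports Defs
begin

text \<open>Write \<open>p\<^sub>K\<close> for the seminorm of a \<open>\<sigma>(Y,X)\<close>-compact set \<open>K\<close>, and \<open>T'(t)\<close> for the adjoint of \<open>T(t)\<close>
  on \<open>Y\<close>, which exists because a weakly continuous functional is given by the pairing. The set
  \<open>{e\<^sup>-\<^sup>\<alpha>\<^sup>t T'(t) y | t \<ge> 0, y \<in> K} \<union> {0}\<close> is the image of \<open>[0,1] \<times> K\<close> under
  \<open>(s, y) \<mapsto> s\<^sup>\<alpha> T'(-ln s) y\<close>. If this map is jointly continuous into \<open>\<sigma>(Y,X)\<close>, the image \<open>L\<close> is
  compact and \<open>p\<^sub>K (e\<^sup>-\<^sup>\<alpha>\<^sup>t T(t) x) \<le> p\<^sub>L x\<close> for all \<open>t \<ge> 0\<close>, which is the equicontinuity. Joint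
  continuity amounts to \<open>p\<^sub>K\<close>-continuity of \<open>s \<mapsto> s\<^sup>\<alpha> T(-ln s) x\<close> on \<open>[0,1]\<close>: for \<open>s > 0\<close> this is the
  continuity hypothesis, and at \<open>s = 0\<close> it follows from \<open>\<alpha> > \<omega>\<close> because \<open>p\<^sub>K\<close> is bounded by a
  multiple of the norm, by the Baire category theorem.\<close>

section \<open>Seminorm estimates by scaling and by Baire category\<close>

text \<open>Homogeneity: if \<open>q x > 0\<close>, rescale \<open>x\<close> to
  \<open>q\<close>-length \<open>d / 2\<close>, strictly inside the open ball, whence the factor 2.
  If \<open>q x = 0\<close>, every multiple of \<open>x\<close> lies in the ball.\<close>

lemma seminorm_dominated_if_bounded_on_ball:
  fixes p q :: "'x::real_vector \<Rightarrow> real"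
  assumes p_scale: "\<And>r x. p (r *\<^sub>R x) = \<bar>r\<bar> * p x"
    and q_scale: "\<And>r x. q (r *\<^sub>R x) = \<bar>r\<bar> * q x"
    and q_nonneg: "\<And>x. 0 \<le> q x"
    and c: "0 \<le> c" and d: "0 < d"
    and bound: "\<And>x. q x < d \<Longrightarrow> p x \<le> c"
  shows "p x \<le> 2 * c / d * q x"
proof (cases "q x = 0")
  case True
  have "p x \<le> 0"
  proof (rule ccontr)
    assume pos: "\<not> p x \<le> 0"
    \<comment> \<open>This multiple of \<open>x\<close> has \<open>p\<close>-value
      \<open>c + 1\<close>, exceeding the bound \<open>c\<close>.\<close>
    have "q (((c + 1) / p x) *\<^sub>R x) < d"
      using True d by (simp add: q_scale)
    then have "p (((c + 1) / p x) *\<^sub>R x) \<le> c" by (rule bound)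
    then show False using pos c by (simp add: p_scale)
  qed
  then show ?thesis using True by simp
next
  case False
  then have pos: "q x > 0" using q_nonneg[of x] by simp
  have "q ((d / (2 * q x)) *\<^sub>R x) < d"
    using pos d by (simp add: q_scale)
  then have "p ((d / (2 * q x)) *\<^sub>R x) \<le> c" by (rule bound)
  then have "d / (2 * q x) * p x \<le> c" using pos d by (simp add: p_scale)
  then show ?thesis using pos d by (simp add: field_simps)
qed

text \<open>The closed sets \<open>{x. p x \<le> n}\<close> cover the space, so by Baire one of them
  contains a ball. Subtracting its centre costs another \<open>n\<close> and gives
  \<open>p \<le> 2 * n\<close> on a ball about 0.\<close>

lemma closed_seminorm_bounded:
  fixes p :: "'x::banach \<Rightarrow> real"
  assumes triangle: "\<And>x y. p (x + y) \<le> p x + p y"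
    and scale: "\<And>r x. p (r *\<^sub>R x) = \<bar>r\<bar> * p x"
    and closed: "\<And>c. closed {x. p x \<le> c}"
  shows "\<exists>C\<ge>0. \<forall>x. p x \<le> C * norm x"
proof -
  have "\<exists>n::nat. interior {x. p x \<le> real n} \<noteq> {}"
  proof (rule ccontr)
    assume "\<not> ?thesis"
    then have "Met_TC.mtopology interior_of \<Union> (range (\<lambda>n::nat. {x. p x \<le> real n})) = {}"
      by (intro Met_TC.metric_Baire_category_alt) (auto simp: closed complete_UNIV)
    moreover have "\<Union> (range (\<lambda>n::nat. {x. p x \<le> real n})) = UNIV"
      using real_arch_simple by blast
    ultimately show False by simp
  qed
  then obtain n :: nat and x0 where "x0 \<in> interior {x. p x \<le> real n}" by blast
  then obtain e where e: "e > 0" and ball: "ball x0 e \<subseteq> {x. p x \<le> real n}"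
    by (auto simp: mem_interior)
  have p_minus: "p (- x) = p x" for x using scale[of "-1" x] by simp
  have "p v \<le> 2 * real n" if "norm v < e" for v
  proof -
    have "x0 + v \<in> ball x0 e" "x0 \<in> ball x0 e" using that e by (auto simp: dist_norm)
    then have "p (x0 + v) \<le> real n" "p x0 \<le> real n" using ball by blast+
    moreover have "p v \<le> p (x0 + v) + p (- x0)" using triangle[of "x0 + v" "- x0"] by simp
    ultimately show ?thesis by (simp add: p_minus)
  qed
  then have "p x \<le> 2 * (2 * real n) / e * norm x" for x
    by (intro seminorm_dominated_if_bounded_on_ball) (auto simp: scale e)
  then show ?thesis using e by (intro exI[of _ "2 * (2 * real n) / e"]) auto
qed

section \<open>Weak topologies\<close>

text \<open>This is \<open>p\<^sub>K\<close>, a name for the function occurring in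
  \<open>tau_c\<close>. It is meaningful only for nonempty \<open>K\<close> on which the pairing
  with \<open>x\<close> is bounded.\<close>

definition sup_seminorm :: "('x \<Rightarrow> 'y \<Rightarrow> 'k::real_normed_field) \<Rightarrow> 'y set \<Rightarrow> 'x \<Rightarrow> real" where
  "sup_seminorm pairing K x = (SUP y\<in>K. norm (pairing x y))"

lemma sup_seminorm_least:
  "K \<noteq> {} \<Longrightarrow> (\<And>y. y \<in> K \<Longrightarrow> norm (pairing x y) \<le> c) \<Longrightarrow> sup_seminorm pairing K x \<le> c"
  unfolding sup_seminorm_def by (rule cSUP_least)

text \<open>A subbasic set constrains a single \<open>y\<close>, and intersections join the finite
  sets. Equality on \<open>F\<close> replaces the usual estimates: it suffices later that a
  neighbourhood of 0 contains the annihilator of a finite set.\<close>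

lemma openin_weak_topology_finite:
  assumes "openin (weak_topology pairing) U" "x0 \<in> U"
  shows "\<exists>F. finite F \<and> (\<forall>x. (\<forall>y\<in>F. pairing x y = pairing x0 y) \<longrightarrow> x \<in> U)"
proof -
  have "generate_topology_on {(\<lambda>x. pairing x y) -` V | y V. open V} U"
    using assms(1) by (simp add: weak_topology_def openin_topology_generated_by_iff)
  then show ?thesis using assms(2)
  proof (induction U)
    case Empty
    then show ?case by simp
  next
    case (Int a b)
    have "x0 \<in> a" "x0 \<in> b" using Int.prems by auto
    obtain F where F: "finite F" "\<And>x. \<forall>y\<in>F. pairing x y = pairing x0 y \<Longrightarrow> x \<in> a"
      using Int.IH(1)[OF \<open>x0 \<in> a\<close>] by blast
    obtain G where G: "finite G" "\<And>x. \<forall>y\<in>G. pairing x y = pairing x0 y \<Longrightarrow> x \<in> b"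
      using Int.IH(2)[OF \<open>x0 \<in> b\<close>] by blast
    have "x \<in> a \<inter> b" if "\<forall>y\<in>F \<union> G. pairing x y = pairing x0 y" for x
      using F(2)[of x] G(2)[of x] that by blast
    then show ?case using F(1) G(1) by (meson finite_UnI)
  next
    case (UN \<U>)
    then obtain A where "A \<in> \<U>" "x0 \<in> A" by blast
    then show ?case using UN.IH[of A] by (meson Union_iff)
  next
    case (Basis s)
    then obtain y V where "s = (\<lambda>x. pairing x y) -` V" by blast
    with Basis(2) show ?case by (intro exI[of _ "{y}"]) simp
  qed
qed

lemma topspace_weak_topology [simp]: "topspace (weak_topology pairing) = UNIV"
  by (auto simp: weak_topology_def intro!: exI[of _ UNIV])

lemma continuous_map_pairing:
  "continuous_map (weak_topology pairing) euclidean (\<lambda>x. pairing x y)"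
  unfolding continuous_map_alt topspace_weak_topology
  by (auto simp del: topology_generated_by_topspace
      simp: weak_topology_def intro!: topology_generated_by_Basis)

text \<open>The universal property of an initial topology.\<close>

lemma continuous_map_into_weak_topology:
  assumes "\<And>y. continuous_map Z euclidean (\<lambda>z. pairing (f z) y)"
  shows "continuous_map Z (weak_topology pairing) f"
  unfolding weak_topology_def
proof (rule continuous_on_generated_topo)
  fix U assume "U \<in> {(\<lambda>x. pairing x y) -` V | y V. open V}"
  then obtain y V where U: "U = (\<lambda>x. pairing x y) -` V" and "open V" by blast
  have "openin Z ((\<lambda>z. pairing (f z) y) -` V \<inter> topspace Z)"
    using assms[of y] \<open>open V\<close> by (simp add: continuous_map_alt)
  then show "openin Z (f -` U \<inter> topspace Z)" by (simp add: U vimage_def)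
qed (auto intro!: exI[of _ UNIV])

section \<open>Weakly continuous functionals and adjoints\<close>

context dual_pair
begin

abbreviation weakly_compact :: "'y set \<Rightarrow> bool" where
  "weakly_compact K \<equiv> compactin (weak_topology (\<lambda>y x. pairing x y)) K"

lemma pairing_left [simp]:
  "pairing (x + x') y = pairing x y + pairing x' y" "pairing 0 y = 0"
  "pairing (- x) y = - pairing x y" "pairing (x - x') y = pairing x y - pairing x' y"
  "pairing (scaleX a x) y = a * pairing x y"
  using linear_left[THEN module_hom_linearI, of y]
  by (auto dest: module_hom.add module_hom.zero module_hom.neg module_hom.diff module_hom.scale)

lemma pairing_right [simp]:
  "pairing x (y + y') = pairing x y + pairing x y'" "pairing x 0 = 0"
  "pairing x (- y) = - pairing x y" "pairing x (y - y') = pairing x y - pairing x y'"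
  "pairing x (scaleY a y) = a * pairing x y"
  using linear_right[THEN module_hom_linearI, of x]
  by (auto dest: module_hom.add module_hom.zero module_hom.neg module_hom.diff module_hom.scale)

text \<open>Induction on \<open>F\<close>. Either the annihilator of \<open>F\<close> also
  annihilates the new \<open>y\<close>, or some \<open>x0\<close> in it does not, and subtracting a
  multiple of the functional of \<open>y\<close> reduces to \<open>F\<close>.\<close>

lemma functional_vanishing_on_finite_annihilator:
  assumes "finite F"
    and "Vector_Spaces.linear scaleX (*) \<phi>"
    and "\<And>x. (\<And>y. y \<in> F \<Longrightarrow> pairing x y = 0) \<Longrightarrow> \<phi> x = 0"
  shows "\<exists>y. \<forall>x. \<phi> x = pairing x y"
  using assms
proof (induction F arbitrary: \<phi> rule: finite_induct)
  case empty
  then show ?case by (intro exI[of _ 0]) simp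
next
  case (insert y F)
  note lin = insert.prems(1)[THEN module_hom_linearI]
  show ?case
  proof (cases "\<exists>x0. (\<forall>z\<in>F. pairing x0 z = 0) \<and> pairing x0 y \<noteq> 0")
    case True
    then obtain x0 where x0: "\<And>z. z \<in> F \<Longrightarrow> pairing x0 z = 0" "pairing x0 y \<noteq> 0" by blast
    \<comment> \<open>Chosen so that \<open>\<psi> x0 = 0\<close>.\<close>
    define c where "c = \<phi> x0 / pairing x0 y"
    define \<psi> where "\<psi> = (\<lambda>x. \<phi> x - c * pairing x y)"
    have "Vector_Spaces.linear scaleX (*) \<psi>"
      using insert.prems(1) unfolding \<psi>_def Vector_Spaces.linear_iff by (simp add: algebra_simps)
    moreover have "\<psi> x = 0" if x: "\<And>z. z \<in> F \<Longrightarrow> pairing x z = 0" for x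
    proof -
      \<comment> \<open>The correction by \<open>x0\<close> makes the vector annihilate
        \<open>y\<close> as well; its value under \<open>\<phi>\<close> is
        \<open>\<psi> x\<close>.\<close>
      have "\<phi> (x - scaleX (pairing x y / pairing x0 y) x0) = 0"
        by (rule insert.prems(2)) (auto simp: x x0)
      then show ?thesis
        by (simp add: \<psi>_def c_def module_hom.diff[OF lin] module_hom.scale[OF lin])
    qed
    ultimately obtain z where "\<forall>x. \<psi> x = pairing x z" using insert.IH by blast
    then have "\<phi> x = pairing x (z + scaleY c y)" for x
      by (simp add: \<psi>_def algebra_simps)
    then show ?thesis by blast
  next
    case False
    then show ?thesis using insert.IH[OF insert.prems(1)] insert.prems(2) by (metis insert_iff)
  qed
qed

text \<open>Near 0 the functional has values in the unit ball, hence on the annihilator of some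
  finite set; a functional bounded on a subspace vanishes there.\<close>

lemma weakly_continuous_functional:
  assumes lin: "Vector_Spaces.linear scaleX (*) \<phi>"
    and cont: "continuous_map (weak_topology pairing) euclidean \<phi>"
  shows "\<exists>y. \<forall>x. \<phi> x = pairing x y"
proof -
  note hom = lin[THEN module_hom_linearI]
  have "openin (weak_topology pairing) (\<phi> -` ball 0 1)"
    using cont by (auto simp: continuous_map_alt)
  moreover have "0 \<in> \<phi> -` ball 0 1" by (simp add: module_hom.zero[OF hom])
  ultimately obtain F where "finite F"
    and F: "\<And>x. (\<forall>y\<in>F. pairing x y = pairing 0 y) \<Longrightarrow> x \<in> \<phi> -` ball 0 1"
    using openin_weak_topology_finite by metis
  have "\<phi> x = 0" if x: "\<And>y. y \<in> F \<Longrightarrow> pairing x y = 0" for x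
  proof (rule ccontr)
    assume "\<phi> x \<noteq> 0"
    \<comment> \<open>The scaled vector still annihilates \<open>F\<close>, but
      \<open>\<phi>\<close> maps it to 1, outside the open ball.\<close>
    have "scaleX (1 / \<phi> x) x \<in> \<phi> -` ball 0 1" by (rule F) (simp add: x)
    then show False using \<open>\<phi> x \<noteq> 0\<close> by (simp add: module_hom.scale[OF hom])
  qed
  then show ?thesis
    using functional_vanishing_on_finite_annihilator[OF \<open>finite F\<close> lin] by blast
qed

lemma weakly_continuous_adjoint:
  assumes "S \<in> continuous_operators scaleX (weak_topology pairing)"
  shows "\<exists>S'. \<forall>x y. pairing (S x) y = pairing x (S' y)"
proof -
  have lin: "Vector_Spaces.linear scaleX scaleX S"
    and cont: "continuous_map (weak_topology pairing) (weak_topology pairing) S"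
    using assms by (auto simp: continuous_operators_def)
  have "\<exists>y'. \<forall>x. pairing (S x) y = pairing x y'" for y
  proof (rule weakly_continuous_functional)
    show "Vector_Spaces.linear scaleX (*) (\<lambda>x. pairing (S x) y)"
      using Vector_Spaces.linear_compose[OF lin linear_left[of y]] by (simp add: o_def)
    show "continuous_map (weak_topology pairing) euclidean (\<lambda>x. pairing (S x) y)"
      using continuous_map_compose[OF cont continuous_map_pairing] by (simp add: o_def)
  qed
  then show ?thesis by metis
qed

section \<open>Seminorms of weakly compact sets\<close>

text \<open>A continuous image of a compact set is bounded; this makes the supremum in
  \<open>sup_seminorm\<close> genuine.\<close>

lemma bdd_above_weakly_compact:
  assumes "weakly_compact K"
  shows "bdd_above ((\<lambda>y. norm (pairing x y)) ` K)"
proof -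
  have "compactin euclidean ((\<lambda>y. pairing x y) ` K)"
    using assms continuous_map_pairing by (rule image_compactin)
  then have "bounded ((\<lambda>y. pairing x y) ` K)" by (simp add: compact_imp_bounded)
  then show ?thesis by (auto simp: bounded_iff bdd_above_def)
qed

lemma norm_pairing_le_sup_seminorm:
  "weakly_compact K \<Longrightarrow> y \<in> K \<Longrightarrow> norm (pairing x y) \<le> sup_seminorm pairing K x"
  unfolding sup_seminorm_def by (rule cSUP_upper[OF _ bdd_above_weakly_compact])

lemma sup_seminorm_minus_commute:
  "sup_seminorm pairing K (x - z) = sup_seminorm pairing K (z - x)"
  unfolding sup_seminorm_def by (simp add: norm_minus_commute)

context
  fixes K
  assumes K: "weakly_compact K" "K \<noteq> {}"
begin

lemma sup_seminorm_nonneg: "0 \<le> sup_seminorm pairing K x"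
  using norm_pairing_le_sup_seminorm[OF K(1)] K(2) by (meson ex_in_conv norm_ge_zero order_trans)

lemma sup_seminorm_zero: "sup_seminorm pairing K 0 = 0"
  using sup_seminorm_nonneg[of 0] sup_seminorm_least[OF K(2), of pairing 0 0] by simp

lemma sup_seminorm_triangle:
  "sup_seminorm pairing K (x + x') \<le> sup_seminorm pairing K x + sup_seminorm pairing K x'"
proof (rule sup_seminorm_least[OF K(2)])
  fix y assume "y \<in> K"
  then show "norm (pairing (x + x') y) \<le> sup_seminorm pairing K x + sup_seminorm pairing K x'"
    using norm_triangle_ineq[of "pairing x y" "pairing x' y"]
      norm_pairing_le_sup_seminorm[OF K(1), of y x] norm_pairing_le_sup_seminorm[OF K(1), of y x']
    by simp
qed

lemma sup_seminorm_scale: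
  "sup_seminorm pairing K (scaleX a x) = norm a * sup_seminorm pairing K x"
proof -
  have le: "sup_seminorm pairing K (scaleX b z) \<le> norm b * sup_seminorm pairing K z" for b z
    by (rule sup_seminorm_least[OF K(2)])
      (simp add: norm_mult norm_pairing_le_sup_seminorm[OF K(1)] mult_left_mono)
  show ?thesis
  proof (cases "a = 0")
    case True
    then show ?thesis by (simp add: sup_seminorm_zero)
  next
    \<comment> \<open>The reverse inequality is \<open>le\<close> for the scalar
      \<open>1 / a\<close> and the vector \<open>scaleX a x\<close>.\<close>
    case False
    then have "sup_seminorm pairing K x \<le> norm (1 / a) * sup_seminorm pairing K (scaleX a x)"
      using le[of "1 / a" "scaleX a x"] by simp
    then have "norm a * sup_seminorm pairing K x \<le> sup_seminorm pairing K (scaleX a x)"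
      using False by (simp add: norm_divide field_simps)
    with le show ?thesis by (simp add: antisym)
  qed
qed

lemma sup_seminorm_diff_triangle:
  "sup_seminorm pairing K (x - z) \<le> sup_seminorm pairing K (x - w) + sup_seminorm pairing K (w - z)"
  using sup_seminorm_triangle[of "x - w" "w - z"] by simp

end

section \<open>The topology \<open>tau_c\<close> and its continuous seminorms\<close>

lemma openin_tau_c_ball:
  "weakly_compact K \<Longrightarrow> K \<noteq> {} \<Longrightarrow> 0 < d \<Longrightarrow>
    openin (tau_c pairing) {x. sup_seminorm pairing K (x - a) < d}"
  unfolding tau_c_def lc_topology_def sup_seminorm_def[abs_def]
  by (intro topology_generated_by_Basis CollectI
      exI[of _ "\<lambda>x. SUP y\<in>K. norm (pairing x y)"] exI[of _ a] exI[of _ d]) auto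

lemma sup_seminorm_mono:
  "weakly_compact L \<Longrightarrow> K \<subseteq> L \<Longrightarrow> K \<noteq> {} \<Longrightarrow> sup_seminorm pairing K x \<le> sup_seminorm pairing L x"
  by (rule sup_seminorm_least) (auto intro: norm_pairing_le_sup_seminorm)

lemma weakly_compact_singleton: "weakly_compact {y}"
  by (simp add: finite_imp_compactin)

lemma topspace_tau_c [simp]: "topspace (tau_c pairing) = UNIV"
proof -
  have "x \<in> topspace (tau_c pairing)" for x
    using openin_subset[OF openin_tau_c_ball[of "{0}" 1 x]]
    by (auto simp: weakly_compact_singleton sup_seminorm_zero)
  then show ?thesis by blast
qed

text \<open>One seminorm suffices at each point because the family is directed:
  \<open>p\<^sub>K\<close> and \<open>p\<^sub>L\<close> are both below the seminorm of
  \<open>K \<union> L\<close>. Generating balls with other centres are recentred by the triangle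
  inequality.\<close>

lemma openin_tau_c_iff:
  "openin (tau_c pairing) U \<longleftrightarrow>
    (\<forall>x0\<in>U. \<exists>K d. weakly_compact K \<and> K \<noteq> {} \<and> 0 < d \<and>
      {x. sup_seminorm pairing K (x - x0) < d} \<subseteq> U)"
  (is "_ \<longleftrightarrow> ?nbhds U")
proof
  assume "openin (tau_c pairing) U"
  then have "generate_topology_on {{x. p (x - a) < e} | p a e.
      p \<in> {\<lambda>x. SUP y\<in>K. norm (pairing x y) | K. weakly_compact K \<and> K \<noteq> {}} \<and> e > 0} U"
    by (simp add: tau_c_def lc_topology_def openin_topology_generated_by_iff)
  then show "?nbhds U"
  proof (induction U)
    case Empty
    then show ?case by simp
  next
    case (Int A B)
    show ?case
    proof
      fix x0 assume "x0 \<in> A \<inter> B"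
      then have "x0 \<in> A" "x0 \<in> B" by auto
      obtain K d where K: "weakly_compact K" "K \<noteq> {}" "0 < d"
          "{x. sup_seminorm pairing K (x - x0) < d} \<subseteq> A"
        using Int.IH(1)[THEN bspec, OF \<open>x0 \<in> A\<close>] by blast
      obtain L e where L: "weakly_compact L" "L \<noteq> {}" "0 < e"
          "{x. sup_seminorm pairing L (x - x0) < e} \<subseteq> B"
        using Int.IH(2)[THEN bspec, OF \<open>x0 \<in> B\<close>] by blast
      have KL: "weakly_compact (K \<union> L)" using K L by (simp add: compactin_Un)
      have "{x. sup_seminorm pairing (K \<union> L) (x - x0) < min d e} \<subseteq> A \<inter> B"
      proof
        fix x assume "x \<in> {x. sup_seminorm pairing (K \<union> L) (x - x0) < min d e}"
        then show "x \<in> A \<inter> B"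
          using sup_seminorm_mono[OF KL, of K "x - x0"] sup_seminorm_mono[OF KL, of L "x - x0"] K L
          by auto
      qed
      then show "\<exists>K d. weakly_compact K \<and> K \<noteq> {} \<and> 0 < d \<and>
          {x. sup_seminorm pairing K (x - x0) < d} \<subseteq> A \<inter> B"
        using KL K L by (intro exI[of _ "K \<union> L"] exI[of _ "min d e"]) auto
    qed
  next
    case (UN \<U>)
    show ?case
    proof
      fix x0 assume "x0 \<in> \<Union> \<U>"
      then obtain A where "A \<in> \<U>" "x0 \<in> A" by blast
      then obtain K d where "weakly_compact K" "K \<noteq> {}" "0 < d"
          "{x. sup_seminorm pairing K (x - x0) < d} \<subseteq> A"
        using UN.IH[of A] by blast
      then show "\<exists>K d. weakly_compact K \<and> K \<noteq> {} \<and> 0 < d \<and>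
          {x. sup_seminorm pairing K (x - x0) < d} \<subseteq> \<Union> \<U>"
        using \<open>A \<in> \<U>\<close> by (intro exI[of _ K] exI[of _ d]) blast
    qed
  next
    case (Basis s)
    then obtain K a e where K: "weakly_compact K" "K \<noteq> {}" "e > 0"
      and s: "s = {x. sup_seminorm pairing K (x - a) < e}"
      unfolding sup_seminorm_def by blast
    show ?case
    proof
      fix x0 assume "x0 \<in> s"
      then have "{x. sup_seminorm pairing K (x - x0) < e - sup_seminorm pairing K (x0 - a)} \<subseteq> s"
        using sup_seminorm_diff_triangle[OF K(1,2), of _ a x0]
        unfolding s less_diff_eq by (blast intro: le_less_trans)
      then show "\<exists>K d. weakly_compact K \<and> K \<noteq> {} \<and> 0 < d \<and>
          {x. sup_seminorm pairing K (x - x0) < d} \<subseteq> s"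
        using K \<open>x0 \<in> s\<close>
        by (intro exI[of _ K] exI[of _ "e - sup_seminorm pairing K (x0 - a)"]) (auto simp: s)
    qed
  qed
next
  assume nbhds: "?nbhds U"
  show "openin (tau_c pairing) U"
  proof (subst openin_subopen, intro ballI)
    fix x0 assume "x0 \<in> U"
    then obtain K d where K: "weakly_compact K" "K \<noteq> {}" "0 < d"
      "{x. sup_seminorm pairing K (x - x0) < d} \<subseteq> U"
      using nbhds by blast
    then show "\<exists>V. openin (tau_c pairing) V \<and> x0 \<in> V \<and> V \<subseteq> U"
      using openin_tau_c_ball[OF K(1-3), of x0]
      by (intro exI[of _ "{x. sup_seminorm pairing K (x - x0) < d}"])
        (auto simp: sup_seminorm_zero)
  qed
qed

text \<open>By the reverse triangle inequality \<open>p\<^sub>K\<close> is 1-Lipschitz with respect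
  to itself.\<close>

lemma continuous_seminorm_sup_seminorm:
  assumes K: "weakly_compact K" "K \<noteq> {}" and c: "0 \<le> c"
  shows "continuous_seminorm scaleX (tau_c pairing) (\<lambda>x. c * sup_seminorm pairing K x)"
proof -
  note p = sup_seminorm_nonneg[OF K] sup_seminorm_triangle[OF K] sup_seminorm_scale[OF K]
  have "continuous_map (tau_c pairing) euclidean (sup_seminorm pairing K)"
    unfolding continuous_map_alt
  proof (intro conjI allI impI)
    fix V :: "real set" assume "openin euclidean V"
    show "openin (tau_c pairing) (sup_seminorm pairing K -` V \<inter> topspace (tau_c pairing))"
      unfolding openin_tau_c_iff
    proof
      fix x0 assume "x0 \<in> sup_seminorm pairing K -` V \<inter> topspace (tau_c pairing)"
      then obtain e where e: "0 < e" "ball (sup_seminorm pairing K x0) e \<subseteq> V"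
        using \<open>openin euclidean V\<close> openE[of V "sup_seminorm pairing K x0"] by auto
      have "dist (sup_seminorm pairing K x0) (sup_seminorm pairing K x)
          \<le> sup_seminorm pairing K (x - x0)" for x
        using p(2)[of "x - x0" x0] p(2)[of "x0 - x" x] sup_seminorm_minus_commute[of K x x0]
        by (simp add: dist_real_def)
      then have "sup_seminorm pairing K x \<in> V" if "sup_seminorm pairing K (x - x0) < e" for x
        using e(2) that by (meson le_less_trans mem_ball subsetD)
      then have "{x. sup_seminorm pairing K (x - x0) < e}
          \<subseteq> sup_seminorm pairing K -` V \<inter> topspace (tau_c pairing)"
        by auto
      then show "\<exists>L d. weakly_compact L \<and> L \<noteq> {} \<and> 0 < d \<and>
          {x. sup_seminorm pairing L (x - x0) < d}
            \<subseteq> sup_seminorm pairing K -` V \<inter> topspace (tau_c pairing)"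
        using K e(1) by blast
    qed
  qed auto
  then have "continuous_map (tau_c pairing) euclidean (\<lambda>x. c * sup_seminorm pairing K x)"
    by (intro continuous_map_real_mult) auto
  moreover have "c * sup_seminorm pairing K (x + y)
      \<le> c * sup_seminorm pairing K x + c * sup_seminorm pairing K y" for x y
    using mult_left_mono[OF p(2) c] by (simp add: distrib_left)
  ultimately show ?thesis
    using c by (simp add: continuous_seminorm_def p(1,3))
qed

section \<open>Continuity criteria for the pairing and for operators\<close>

text \<open>Two halves of \<open>e\<close>: \<open>p\<^sub>K\<close> controls the change from
  \<open>g s0\<close> to \<open>g s\<close> uniformly in \<open>y \<in> K\<close>, and weak
  continuity of the pairing with the fixed vector \<open>g s0\<close> controls the change from
  \<open>y0\<close> to \<open>y\<close>.\<close>

lemma weak_topology_jointly_continuous: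
  assumes K: "weakly_compact K"
    and g: "\<And>s0. s0 \<in> I \<Longrightarrow> ((\<lambda>s. sup_seminorm pairing K (g s - g s0)) \<longlongrightarrow> 0) (at s0 within I)"
  shows "continuous_map (prod_topology (top_of_set I)
      (subtopology (weak_topology (\<lambda>y x. pairing x y)) K)) euclidean (\<lambda>(s, y). pairing (g s) y)"
    (is "continuous_map (prod_topology ?I ?K) euclidean ?h")
  unfolding continuous_map_eq_topcontinuous_at topcontinuous_at_def
proof (intro ballI conjI allI impI)
  fix z V assume z: "z \<in> topspace (prod_topology ?I ?K)"
    and V: "openin euclidean V \<and> ?h z \<in> V"
  obtain s0 y0 where z_eq: "z = (s0, y0)" by (cases z)
  then have s0: "s0 \<in> I" and y0: "y0 \<in> K" using z by auto
  obtain e where e: "0 < e" "ball (pairing (g s0) y0) e \<subseteq> V"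
    using V openE[of V "pairing (g s0) y0"] by (auto simp: z_eq)
  have "\<forall>\<^sub>F s in at s0 within I. sup_seminorm pairing K (g s - g s0) < e / 2"
    using order_tendstoD(2)[OF g[OF s0], of "e / 2"] e by simp
  then obtain A where A: "open A" "s0 \<in> A"
    "\<And>s. s \<in> A \<Longrightarrow> s \<noteq> s0 \<Longrightarrow> s \<in> I \<Longrightarrow> sup_seminorm pairing K (g s - g s0) < e / 2"
    unfolding eventually_at_topological by blast
  \<comment> \<open>The filter \<open>at s0 within I\<close> omits \<open>s0\<close>, where the
    seminorm is 0.\<close>
  have A': "sup_seminorm pairing K (g s - g s0) < e / 2" if "s \<in> A" "s \<in> I" for s
    using A(3)[of s] that e sup_seminorm_zero[OF K, OF ex_in_conv[THEN iffD1, OF exI[of _ y0], OF y0]]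
    by (cases "s = s0") auto
  define B where "B = (\<lambda>y. pairing (g s0) y) -` ball (pairing (g s0) y0) (e / 2)"
  have "openin (weak_topology (\<lambda>y x. pairing x y)) B"
    using continuous_map_pairing[of "\<lambda>y x. pairing x y" "g s0"]
    by (simp add: continuous_map_alt B_def)
  then have "openin ?K (B \<inter> K)" by (auto simp: openin_subtopology)
  moreover have "openin ?I (A \<inter> I)" using A(1) by (auto simp: openin_open)
  ultimately have "openin (prod_topology ?I ?K) ((A \<inter> I) \<times> (B \<inter> K))"
    by (simp add: openin_prod_Times_iff)
  moreover have "z \<in> (A \<inter> I) \<times> (B \<inter> K)" using A(2) s0 y0 e by (simp add: z_eq B_def)
  moreover have "?h w \<in> V" if "w \<in> (A \<inter> I) \<times> (B \<inter> K)" for w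
  proof -
    obtain s y where w: "w = (s, y)" by (cases w)
    have "norm (pairing (g s - g s0) y) < e / 2"
      using norm_pairing_le_sup_seminorm[OF K, of y "g s - g s0"] A'[of s] that
      by (auto simp: w)
    moreover have "norm (pairing (g s0) y0 - pairing (g s0) y) < e / 2"
      using that by (simp add: w B_def dist_norm)
    moreover have "norm (pairing (g s0) y0 - pairing (g s) y)
        = norm ((pairing (g s0) y0 - pairing (g s0) y) - pairing (g s - g s0) y)" by simp
    ultimately have "norm (pairing (g s0) y0 - pairing (g s) y) < e"
      using norm_triangle_ineq4[of "pairing (g s0) y0 - pairing (g s0) y" "pairing (g s - g s0) y"]
      by linarith
    then show ?thesis using e(2) by (auto simp: w dist_norm)
  qed
  ultimately show "\<exists>U. openin (prod_topology ?I ?K) U \<and> z \<in> U \<and> (\<forall>y\<in>U. ?h y \<in> V)" by blast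
qed auto


lemma continuous_map_into_tau_c_tendsto:
  assumes K: "weakly_compact K" "K \<noteq> {}"
    and f: "continuous_map (top_of_set I) (tau_c pairing) f" and s0: "s0 \<in> I"
  shows "((\<lambda>s. sup_seminorm pairing K (f s - f s0)) \<longlongrightarrow> 0) (at s0 within I)"
proof (rule tendstoI)
  fix e :: real assume e: "0 < e"
  let ?S = "{s \<in> I. sup_seminorm pairing K (f s - f s0) < e}"
  have "openin (top_of_set I) ?S"
    using openin_continuous_map_preimage[OF f openin_tau_c_ball[OF K e]] by simp
  then obtain A where "open A" and A: "?S = I \<inter> A"
    unfolding openin_open by blast
  have "s0 \<in> ?S" using s0 e by (simp add: sup_seminorm_zero[OF K])
  then have "s0 \<in> A" using A by blast
  moreover have "dist (sup_seminorm pairing K (f s - f s0)) 0 < e" if "s \<in> A" "s \<in> I" for s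
  proof -
    have "s \<in> ?S" using that A by blast
    then show ?thesis by (simp add: sup_seminorm_nonneg[OF K])
  qed
  ultimately show "\<forall>\<^sub>F s in at s0 within I. dist (sup_seminorm pairing K (f s - f s0)) 0 < e"
    using \<open>open A\<close> unfolding eventually_at_topological by blast
qed

text \<open>The preimage of a \<open>p\<^sub>K\<close>-ball about \<open>S x0\<close> contains the
  \<open>p\<^sub>L\<close>-ball of the same radius about \<open>x0\<close>.\<close>

lemma continuous_map_tau_c_if_dominated:
  assumes S: "\<And>x z. S (x - z) = S x - S z"
    and dom: "\<And>K. weakly_compact K \<Longrightarrow> K \<noteq> {} \<Longrightarrow>
      \<exists>L. weakly_compact L \<and> L \<noteq> {} \<and> (\<forall>x. sup_seminorm pairing K (S x) \<le> sup_seminorm pairing L x)"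
  shows "continuous_map (tau_c pairing) (tau_c pairing) S"
  unfolding continuous_map_alt
proof (intro conjI allI impI)
  fix U assume U: "openin (tau_c pairing) U"
  show "openin (tau_c pairing) (S -` U \<inter> topspace (tau_c pairing))"
    unfolding openin_tau_c_iff
  proof
    fix x0 assume "x0 \<in> S -` U \<inter> topspace (tau_c pairing)"
    then have "S x0 \<in> U" by simp
    then obtain K d where K: "weakly_compact K" "K \<noteq> {}" "0 < d"
      and KU: "{x. sup_seminorm pairing K (x - S x0) < d} \<subseteq> U"
      using U unfolding openin_tau_c_iff by blast
    obtain L where L: "weakly_compact L" "L \<noteq> {}"
      and KL: "\<And>x. sup_seminorm pairing K (S x) \<le> sup_seminorm pairing L x"
      using dom[OF K(1,2)] by blast
    have "S x \<in> U" if "sup_seminorm pairing L (x - x0) < d" for x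
      using KL[of "x - x0"] that KU by (auto simp: S)
    then show "\<exists>K d. weakly_compact K \<and> K \<noteq> {} \<and> 0 < d \<and>
        {x. sup_seminorm pairing K (x - x0) < d} \<subseteq> S -` U \<inter> topspace (tau_c pairing)"
      using L K(3) by (intro exI[of _ L] exI[of _ d]) auto
  qed
qed auto

end

section \<open>Norm bounds in a norming dual pair\<close>

context norming_dual_pair
begin

text \<open>Normalise \<open>y\<close> and use the supremum formula for
  \<open>norm x\<close>.\<close>

lemma norm_pairing_le: "norm (pairing x y) \<le> norm x * norm y"
proof (cases "y = 0")
  case False
  define u where "u = scaleY (of_real (1 / norm y)) y"
  have "norm u \<le> 1" using False by (simp add: u_def Y.norm_scale del: of_real_divide)
  then have "norm (pairing x u) \<le> norm x"
    unfolding norm_left[of x] by (intro cSUP_upper bdd_left) simp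
  moreover have "norm (pairing x u) = norm (pairing x y) / norm y"
    by (simp add: u_def norm_mult del: of_real_divide)
  ultimately show ?thesis using False by (simp add: field_simps)
qed simp

lemma bounded_linear_pairing: "bounded_linear (\<lambda>x. pairing x y)"
proof (rule bounded_linear_intro)
  show "pairing (r *\<^sub>R x) y = r *\<^sub>R pairing x y" for r x
    unfolding X.scale_of_real[symmetric] by (simp add: scaleR_conv_of_real)
  show "norm (pairing x y) \<le> norm x * norm y" for x by (rule norm_pairing_le)
qed simp

lemma sup_seminorm_scaleR:
  assumes "weakly_compact K" "K \<noteq> {}"
  shows "sup_seminorm pairing K (r *\<^sub>R x) = \<bar>r\<bar> * sup_seminorm pairing K x"
  using sup_seminorm_scale[OF assms, of "of_real r" x] by (simp add: X.scale_of_real)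

text \<open>Uniform boundedness: each sublevel set of \<open>p\<^sub>K\<close> is an intersection of
  norm-closed sets, one for each \<open>y \<in> K\<close>, so the Baire argument applies.\<close>

lemma sup_seminorm_norm_bounded:
  assumes K: "weakly_compact K" "K \<noteq> {}"
  shows "\<exists>C\<ge>0. \<forall>x. sup_seminorm pairing K x \<le> C * norm x"
proof (rule closed_seminorm_bounded)
  fix c
  have "{x. sup_seminorm pairing K x \<le> c} = (\<Inter>y\<in>K. {x. norm (pairing x y) \<le> c})"
    by (auto intro: sup_seminorm_least[OF K(2)]
        order_trans[OF norm_pairing_le_sup_seminorm[OF K(1)]])
  also have "closed \<dots>"
  proof (intro closed_INT ballI closed_Collect_le)
    show "continuous_on UNIV (\<lambda>x. norm (pairing x y))" for y
      by (intro continuous_on_norm linear_continuous_on bounded_linear_pairing)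
  qed (rule continuous_on_const)
  finally show "closed {x. sup_seminorm pairing K x \<le> c}" .
qed (simp_all add: sup_seminorm_triangle[OF K] sup_seminorm_scaleR[OF K])

text \<open>Continuity at 0 gives a \<open>p\<^sub>K\<close>-ball on which \<open>p < 1\<close>;
  scaling does the rest. Thus equicontinuity need only be checked for the seminorms
  \<open>p\<^sub>K\<close>.\<close>

lemma continuous_seminorm_dominated:
  assumes "continuous_seminorm scaleX (tau_c pairing) p"
  shows "\<exists>K c. weakly_compact K \<and> K \<noteq> {} \<and> 0 \<le> c \<and> (\<forall>x. p x \<le> c * sup_seminorm pairing K x)"
proof -
  have scale: "p (r *\<^sub>R x) = \<bar>r\<bar> * p x" for r x
    using assms unfolding continuous_seminorm_def X.scale_of_real[symmetric] by simp
  have "openin (tau_c pairing) (p -` {..<1} \<inter> topspace (tau_c pairing))"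
    using assms unfolding continuous_seminorm_def continuous_map_alt by simp
  moreover have "0 \<in> p -` {..<1} \<inter> topspace (tau_c pairing)"
    using scale[of 0 0] by simp
  ultimately obtain K d where K: "weakly_compact K" "K \<noteq> {}" "0 < d"
    "{x. sup_seminorm pairing K (x - 0) < d} \<subseteq> p -` {..<1} \<inter> topspace (tau_c pairing)"
    unfolding openin_tau_c_iff by blast
  have "p x \<le> 2 * 1 / d * sup_seminorm pairing K x" for x
    using K(3,4)
    by (intro seminorm_dominated_if_bounded_on_ball)
      (auto simp: scale sup_seminorm_scaleR[OF K(1,2)] sup_seminorm_nonneg[OF K(1,2)])
  then show ?thesis using K by (intro exI[of _ K] exI[of _ "2 * 1 / d"]) auto
qed

section \<open>Equicontinuity of the rescaled semigroup\<close>

text \<open>The substitution \<open>s = exp (- t)\<close> carries the half-line to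
  \<open>{0<..1}\<close>; adjoining \<open>s = 0\<close> as the point at infinity yields one compact
  \<open>L\<close> for all \<open>t\<close>.\<close>

lemma rescaled_semigroup_dominated:
  assumes T: "semigroup_on scaleX pairing T" "of_type M \<omega> T"
      "semigroup_continuous (tau_c pairing) T" "\<alpha> > \<omega>"
    and K: "weakly_compact K" "K \<noteq> {}"
  shows "\<exists>L. weakly_compact L \<and> L \<noteq> {} \<and> (\<forall>t\<ge>0. \<forall>x.
    sup_seminorm pairing K (scaleX (of_real (exp (- \<alpha> * t))) (T t x)) \<le> sup_seminorm pairing L x)"
proof -
  \<comment> \<open>The guard \<open>t \<ge> 0\<close> sits inside the existential so that choice
    gives a total family of adjoints.\<close>
  have "\<forall>t. \<exists>S'. t \<ge> 0 \<longrightarrow> (\<forall>x y. pairing (T t x) y = pairing x (S' y))"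
  proof
    fix t
    show "\<exists>S'. t \<ge> 0 \<longrightarrow> (\<forall>x y. pairing (T t x) y = pairing x (S' y))"
    proof (cases "t \<ge> 0")
      case True
      then have "T t \<in> continuous_operators scaleX (weak_topology pairing)"
        using T(1) by (simp add: semigroup_on_def)
      from weakly_continuous_adjoint[OF this] show ?thesis by blast
    qed simp
  qed
  from choice[OF this] obtain adj
    where adj: "\<And>t x y. t \<ge> 0 \<Longrightarrow> pairing (T t x) y = pairing x (adj t y)" by blast
  \<comment> \<open>At \<open>s = 0\<close> both maps vanish, since \<open>0 powr \<alpha> = 0\<close> for every \<open>\<alpha>\<close>.\<close>
  define g where "g x s = scaleX (of_real (s powr \<alpha>)) (T (- ln s) x)" for x s
  define F where "F = (\<lambda>(s, y). scaleY (of_real (s powr \<alpha>)) (adj (- ln s) y))"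
  have pairing_F: "pairing x (F (s, y)) = pairing (g x s) y" if "s \<in> {0..1}" for x s y
    using that adj[of "- ln s" x y] by (cases "s = 0") (auto simp: F_def g_def)
  obtain C where C: "C \<ge> 0" "\<And>x. sup_seminorm pairing K x \<le> C * norm x"
    using sup_seminorm_norm_bounded[OF K] by blast
  have g_tendsto: "((\<lambda>s. sup_seminorm pairing K (g x s - g x s0)) \<longlongrightarrow> 0) (at s0 within {0..1})"
    if "s0 \<in> {0..1}" for x s0
  proof (cases "s0 = 0")
    case True
    \<comment> \<open>With \<open>t = - ln s\<close> the growth bound
      \<open>exp (\<omega> * t)\<close> becomes \<open>s powr (- \<omega>)\<close>, which leaves a
      positive power of \<open>s\<close>.\<close>
    have "sup_seminorm pairing K (g x s - g x s0) \<le> C * M * norm x * s powr (\<alpha> - \<omega>)"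
      if "s \<in> {0<..1}" for s
    proof -
      have t: "- ln s \<ge> 0" using that by simp
      have "norm (T (- ln s) x) \<le> onorm (T (- ln s)) * norm x"
        using T(2) t by (intro onorm) (auto simp: of_type_def)
      also have "\<dots> \<le> M * exp (\<omega> * - ln s) * norm x"
        using T(2)[unfolded of_type_def] t by (intro mult_right_mono norm_ge_zero) blast
      also have "exp (\<omega> * - ln s) = s powr (- \<omega>)"
        using that by (simp add: powr_def)
      finally have bound: "norm (T (- ln s) x) \<le> M * s powr (- \<omega>) * norm x" .
      have "sup_seminorm pairing K (g x s - g x s0)
          = s powr \<alpha> * sup_seminorm pairing K (T (- ln s) x)"
        by (simp add: g_def True sup_seminorm_scale[OF K])
      also have "\<dots> \<le> s powr \<alpha> * (C * (M * s powr (- \<omega>) * norm x))"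
        using C bound by (intro mult_left_mono order_trans[OF C(2)]) auto
      also have "\<dots> = C * M * norm x * (s powr \<alpha> * s powr (- \<omega>))" by simp
      also have "s powr \<alpha> * s powr (- \<omega>) = s powr (\<alpha> - \<omega>)"
        by (simp flip: powr_add)
      finally show ?thesis .
    qed
    then have upper: "\<forall>\<^sub>F s in at s0 within {0..1}. sup_seminorm pairing K (g x s - g x s0)
        \<le> C * M * norm x * s powr (\<alpha> - \<omega>)"
      unfolding eventually_at_filter True by (intro always_eventually allI impI) simp
    \<comment> \<open>The limit of \<open>powr\<close> at base 0 relies on the exponent
      \<open>\<alpha> - \<omega>\<close> being positive.\<close>
    have "((\<lambda>s. C * M * norm x * s powr (\<alpha> - \<omega>)) \<longlongrightarrow> C * M * norm x * 0 powr (\<alpha> - \<omega>))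
        (at s0 within {0..1})"
      using T(4) unfolding True
      by (intro tendsto_mult tendsto_const tendsto_powr' tendsto_ident_at)
        (simp_all add: eventually_at_filter)
    then have lim: "((\<lambda>s. C * M * norm x * s powr (\<alpha> - \<omega>)) \<longlongrightarrow> 0) (at s0 within {0..1})"
      by simp
    show ?thesis
      by (rule tendsto_sandwich[OF always_eventually upper tendsto_const lim])
        (simp add: sup_seminorm_nonneg[OF K])
  next
    case False
    then have s0: "s0 \<in> {0<..1}" using that by simp
    have "continuous_map (top_of_set {0<..1}) (top_of_set {0..}) (\<lambda>s::real. - ln s)"
      by (auto simp: intro!: continuous_intros)
    moreover have "continuous_map (top_of_set {0..}) (tau_c pairing) (\<lambda>t. T t x)"
      using T(3) by (simp add: semigroup_continuous_def)
    ultimately have "continuous_map (top_of_set {0<..1}) (tau_c pairing) (\<lambda>s. T (- ln s) x)"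
      by (rule continuous_map_compose[unfolded o_def])
    note continuous_map_into_tau_c_tendsto[OF K this s0]
    \<comment> \<open>Continuity of the orbit is available for \<open>s > 0\<close> only; near
      \<open>s0 > 0\<close> the two intervals coincide.\<close>
    moreover have "at s0 within {0<..1} = at s0 within {0..1}"
      using s0 by (intro at_within_nhd[of s0 "{0<..}"]) auto
    ultimately have lim: "((\<lambda>s. sup_seminorm pairing K (T (- ln s) x - T (- ln s0) x)) \<longlongrightarrow> 0)
        (at s0 within {0..1})"
      by simp
    \<comment> \<open>Product rule: first the orbit varies with factor
      \<open>s powr \<alpha>\<close>, then the factor varies with the orbit fixed at
      \<open>s0\<close>.\<close>
    let ?b = "\<lambda>s. s powr \<alpha> * sup_seminorm pairing K (T (- ln s) x - T (- ln s0) x)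
        + \<bar>s powr \<alpha> - s0 powr \<alpha>\<bar> * sup_seminorm pairing K (T (- ln s0) x)"
    have upper: "sup_seminorm pairing K (g x s - g x s0) \<le> ?b s" for s
    proof -
      have "g x s - g x s0 = scaleX (of_real (s powr \<alpha>)) (T (- ln s) x - T (- ln s0) x)
          + scaleX (of_real (s powr \<alpha> - s0 powr \<alpha>)) (T (- ln s0) x)"
        by (simp add: g_def X.scale_right_diff_distrib X.scale_left_diff_distrib)
      then show ?thesis
        using sup_seminorm_triangle[OF K, of "scaleX (of_real (s powr \<alpha>)) (T (- ln s) x - T (- ln s0) x)"
            "scaleX (of_real (s powr \<alpha> - s0 powr \<alpha>)) (T (- ln s0) x)"]
        by (simp only: sup_seminorm_scale[OF K] norm_of_real abs_of_nonneg[OF powr_ge_zero])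
    qed
    have "(?b \<longlongrightarrow> s0 powr \<alpha> * 0 + \<bar>s0 powr \<alpha> - s0 powr \<alpha>\<bar> *
        sup_seminorm pairing K (T (- ln s0) x)) (at s0 within {0..1})"
      using s0 by (intro tendsto_intros lim) auto
    then have lim_b: "(?b \<longlongrightarrow> 0) (at s0 within {0..1})" by simp
    show ?thesis
      by (rule tendsto_sandwich[OF always_eventually always_eventually tendsto_const lim_b])
        (simp_all add: sup_seminorm_nonneg[OF K] upper)
  qed
  let ?D = "prod_topology (top_of_set {0..1::real}) (subtopology (weak_topology (\<lambda>y x. pairing x y)) K)"
  define L where "L = F ` ({0..1} \<times> K)"
  \<comment> \<open>Tested against each \<open>x\<close>, the map \<open>F\<close> becomes the
    pairing of \<open>g x s\<close> with \<open>y\<close>, so joint continuity applies to each orbit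
    separately.\<close>
  have "continuous_map ?D (weak_topology (\<lambda>y x. pairing x y)) F"
  proof (rule continuous_map_into_weak_topology)
    fix x
    show "continuous_map ?D euclidean (\<lambda>z. pairing x (F z))"
      by (rule continuous_map_eq[OF weak_topology_jointly_continuous[OF K(1) g_tendsto[of _ x]]])
        (auto simp: pairing_F)
  qed
  moreover have "compactin ?D ({0..1} \<times> K)"
    using K(1) by (simp add: compactin_Times compactin_subtopology)
  ultimately have L: "weakly_compact L"
    unfolding L_def by (intro image_compactin)
  have "L \<noteq> {}" using K(2) by (auto simp: L_def)
  moreover have "sup_seminorm pairing K (scaleX (of_real (exp (- \<alpha> * t))) (T t x))
      \<le> sup_seminorm pairing L x" if "t \<ge> 0" for t x
  proof (rule sup_seminorm_least[OF K(2)])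
    fix y assume y: "y \<in> K"
    \<comment> \<open>At \<open>s = exp (- t)\<close> one has \<open>- ln s = t\<close> and
      \<open>s powr \<alpha> = exp (- \<alpha> * t)\<close>.\<close>
    have "pairing (scaleX (of_real (exp (- \<alpha> * t))) (T t x)) y = pairing x (F (exp (- t), y))"
      using that by (subst pairing_F) (auto simp: g_def powr_def)
    moreover have "F (exp (- t), y) \<in> L" using y that by (auto simp: L_def)
    ultimately show "norm (pairing (scaleX (of_real (exp (- \<alpha> * t))) (T t x)) y)
        \<le> sup_seminorm pairing L x"
      using norm_pairing_le_sup_seminorm[OF L] by simp
  qed
  ultimately show ?thesis using L by blast
qed

text \<open>Domination serves twice: for a single \<open>t\<close> it gives
  \<open>tau_c\<close>-continuity of the operator, and uniformly in \<open>t\<close> it turns a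
  bound \<open>p \<le> c * p\<^sub>K\<close> into the common seminorm
  \<open>c * p\<^sub>L\<close>.\<close>

lemma rescaled_semigroup_equicontinuous:
  assumes T: "semigroup_on scaleX pairing T" "of_type M \<omega> T"
      "semigroup_continuous (tau_c pairing) T" "\<alpha> > \<omega>"
  shows "quasi_equicontinuous scaleX (tau_c pairing) \<alpha> T"
  unfolding quasi_equicontinuous_def equicontinuous_operators_def
proof (intro conjI subsetI allI impI)
  fix S assume "S \<in> {\<lambda>x. scaleX (of_real (exp (- \<alpha> * t))) (T t x) | t. t \<ge> 0}"
  then obtain t where t: "t \<ge> 0" and S: "S = (\<lambda>x. scaleX (of_real (exp (- \<alpha> * t))) (T t x))"
    by blast
  have "Vector_Spaces.linear scaleX scaleX (T t)"
    using T(1) t by (auto simp: semigroup_on_def continuous_operators_def)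
  then have lin: "Vector_Spaces.linear scaleX scaleX S"
    unfolding S Vector_Spaces.linear_iff
    by (simp add: X.scale_right_distrib X.scale_left_commute)
  have "continuous_map (tau_c pairing) (tau_c pairing) S"
  proof (rule continuous_map_tau_c_if_dominated)
    show "S (x - z) = S x - S z" for x z
      by (rule module_hom.diff[OF module_hom_linearI[OF lin]])
    show "\<exists>L. weakly_compact L \<and> L \<noteq> {} \<and>
        (\<forall>x. sup_seminorm pairing K (S x) \<le> sup_seminorm pairing L x)"
      if "weakly_compact K" "K \<noteq> {}" for K
      unfolding S using rescaled_semigroup_dominated[OF T that] t by meson
  qed
  with lin show "S \<in> continuous_operators scaleX (tau_c pairing)"
    by (simp add: continuous_operators_def)
next
  fix p assume "continuous_seminorm scaleX (tau_c pairing) p"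
  then obtain K c where K: "weakly_compact K" "K \<noteq> {}"
    and c: "0 \<le> c" "\<And>x. p x \<le> c * sup_seminorm pairing K x"
    using continuous_seminorm_dominated by blast
  obtain L where L: "weakly_compact L" "L \<noteq> {}"
    and dom: "\<And>t x. t \<ge> 0 \<Longrightarrow> sup_seminorm pairing K (scaleX (of_real (exp (- \<alpha> * t))) (T t x))
      \<le> sup_seminorm pairing L x"
    using rescaled_semigroup_dominated[OF T K] by blast
  show "\<exists>q. continuous_seminorm scaleX (tau_c pairing) q \<and>
      (\<forall>S\<in>{\<lambda>x. scaleX (of_real (exp (- \<alpha> * t))) (T t x) | t. t \<ge> 0}. \<forall>x. p (S x) \<le> q x)"
  proof (intro exI conjI ballI allI)
    show "continuous_seminorm scaleX (tau_c pairing) (\<lambda>x. c * sup_seminorm pairing L x)"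
      by (rule continuous_seminorm_sup_seminorm[OF L c(1)])
    fix S x assume "S \<in> {\<lambda>x. scaleX (of_real (exp (- \<alpha> * t))) (T t x) | t. t \<ge> 0}"
    then obtain t where "t \<ge> 0" and S: "S = (\<lambda>x. scaleX (of_real (exp (- \<alpha> * t))) (T t x))"
      by blast
    have "p (S x) \<le> c * sup_seminorm pairing K (S x)" by (rule c(2))
    also have "\<dots> \<le> c * sup_seminorm pairing L x"
      unfolding S by (intro mult_left_mono dom c(1) \<open>t \<ge> 0\<close>)
    finally show "p (S x) \<le> c * sup_seminorm pairing L x" .
  qed
qed

end

theorem theorem3p9:
  fixes scaleX :: "'k::real_or_complex_field \<Rightarrow> 'x::banach \<Rightarrow> 'x"
    and scaleY :: "'k \<Rightarrow> 'y::banach \<Rightarrow> 'y"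
    and pairing :: "'x \<Rightarrow> 'y \<Rightarrow> 'k"
    and T :: "real \<Rightarrow> 'x \<Rightarrow> 'x"
    and M \<omega> \<alpha> :: real
  assumes "norming_dual_pair scaleX scaleY pairing"
    and "semigroup_on scaleX pairing T"
    and "of_type M \<omega> T"
    and "semigroup_continuous (tau_c pairing) T"
    and "\<alpha> > \<omega>"
  shows "quasi_equicontinuous scaleX (tau_c pairing) \<alpha> T"
  using assms by (rule norming_dual_pair.rescaled_semigroup_equicontinuous)

end
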